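(* Let $k \ge 4$ be an integer and let $G$ be a finite simple $k$-degenerate graph with maximum degree $\Delta$. Then $a'(G) \le \left\lceil \frac{k+1}{2}\Delta \right\rceil + 1$.
   Context: A graph $G$ is $k$-degenerate if every subgraph of $G$ has a vertex of degree at most $k$. An acyclic edge coloring of $G$ is a proper edge coloring (adjacent edges receive distinct colors) with no bichromatic cycle, i.e., no cycle whose edges use exactly two colors. The acyclic chromatic index $a'(G)$ is the minimum number of colors in an acyclic edge coloring of $G$. *)

theory Defs
  imports Complex_Main
begin

text \<open>Undirected simple graphs: an edge is the two-element set of its end vertices.\<close>

locale simple_graph =
  fixes V :: "'a set" and E :: "'a set set"
  assumes edge_subset: "e \<in> E \<Longrightarrow> e \<subseteq> V"
    and edge_card: "e \<in> E \<Longrightarrow> card e = 2"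

locale finite_simple_graph = simple_graph +
  assumes finite_verts: "finite V"
begin

lemma finite_edges: "finite E"
  using finite_verts edge_subset by (meson PowI finite_Pow_iff finite_subset subsetI)

end

definition subgraph :: "'a set \<Rightarrow> 'a set set \<Rightarrow> 'a set \<Rightarrow> 'a set set \<Rightarrow> bool" where
  "subgraph V' E' V E \<longleftrightarrow> simple_graph V' E' \<and> V' \<subseteq> V \<and> E' \<subseteq> E"

definition degree :: "'a set set \<Rightarrow> 'a \<Rightarrow> nat" where
  "degree E v = card {e \<in> E. v \<in> e}"

text \<open>The graph without vertices is assigned maximum degree 0.\<close>

definition max_degree :: "'a set \<Rightarrow> 'a set set \<Rightarrow> nat" where
  "max_degree V E = (if V = {} then 0 else Max (degree E ` V))"

text \<open>The condition \<open>V' \<noteq> {}\<close> is needed because the empty subgraph has no vertex at all.\<close>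

definition degenerate :: "nat \<Rightarrow> 'a set \<Rightarrow> 'a set set \<Rightarrow> bool" where
  "degenerate k V E \<longleftrightarrow>
     (\<forall>V' E'. subgraph V' E' V E \<and> V' \<noteq> {} \<longrightarrow> (\<exists>v\<in>V'. degree E' v \<le> k))"

definition proper_edge_coloring :: "'a set set \<Rightarrow> ('a set \<Rightarrow> nat) \<Rightarrow> bool" where
  "proper_edge_coloring E c \<longleftrightarrow>
     (\<forall>e\<in>E. \<forall>f\<in>E. e \<noteq> f \<and> e \<inter> f \<noteq> {} \<longrightarrow> c e \<noteq> c f)"

text \<open>
  A cycle is given by the list of its vertices in cyclic order, without repeating the first
  vertex at the end; \<open>rotate1\<close> pairs every vertex with its successor, and the last one with
  the first.
\<close>

definition cycle_edges :: "'a list \<Rightarrow> 'a set set" where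
  "cycle_edges vs = set (map2 (\<lambda>u v. {u, v}) vs (rotate1 vs))"

definition is_cycle :: "'a set set \<Rightarrow> 'a list \<Rightarrow> bool" where
  "is_cycle E vs \<longleftrightarrow> 3 \<le> length vs \<and> distinct vs \<and> cycle_edges vs \<subseteq> E"

definition bichromatic :: "('a set \<Rightarrow> nat) \<Rightarrow> 'a list \<Rightarrow> bool" where
  "bichromatic c vs \<longleftrightarrow> card (c ` cycle_edges vs) = 2"

definition acyclic_edge_coloring :: "'a set set \<Rightarrow> ('a set \<Rightarrow> nat) \<Rightarrow> bool" where
  "acyclic_edge_coloring E c \<longleftrightarrow>
     proper_edge_coloring E c \<and> \<not> (\<exists>vs. is_cycle E vs \<and> bichromatic c vs)"

definition acyclic_chromatic_index :: "'a set set \<Rightarrow> nat" where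
  "acyclic_chromatic_index E = (LEAST n. \<exists>c. acyclic_edge_coloring E c \<and> card (c ` E) = n)"

text \<open>
  The minimum is attained on finite graphs: an injective coloring is acyclic, since a cycle has
  at least three edges.
\<close>

lemma inj_acyclic_edge_coloring:
  assumes "inj_on c E"
  shows "acyclic_edge_coloring E c"
proof -
  have False if cyc: "is_cycle E vs" and bi: "bichromatic c vs" for vs
  proof -
    from cyc have len: "3 \<le> length vs" and dist: "distinct vs" and sub: "cycle_edges vs \<subseteq> E"
      by (auto simp: is_cycle_def)
    from len obtain x y z zs where vs: "vs = x # y # z # zs"
      by (auto simp: numeral_3_eq_3 Suc_le_length_iff)
    define l where "l = last (z # zs)"
    have l: "l \<in> set (z # zs)" by (simp add: l_def)
    have split: "z # zs = butlast (z # zs) @ [l]" by (simp add: l_def)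
    have "(l, x) \<in> set (zip vs (rotate1 vs))"
    proof -
      have "length (x # y # butlast (z # zs)) = length (y # z # zs)" by simp
      moreover have "vs = (x # y # butlast (z # zs)) @ [l]" using split vs by simp
      moreover have "rotate1 vs = (y # z # zs) @ [x]" using vs by simp
      ultimately have "zip vs (rotate1 vs)
          = zip (x # y # butlast (z # zs)) (y # z # zs) @ [(l, x)]"
        using zip_append[of "x # y # butlast (z # zs)" "y # z # zs" "[l]" "[x]"] by simp
      then show ?thesis by simp
    qed
    then have "{l, x} \<in> cycle_edges vs" by (force simp: cycle_edges_def)
    moreover have "{x, y} \<in> cycle_edges vs" by (simp add: vs cycle_edges_def)
    moreover have "{y, z} \<in> cycle_edges vs" by (cases zs) (simp_all add: vs cycle_edges_def)
    ultimately have sub3: "{{x, y}, {y, z}, {l, x}} \<subseteq> cycle_edges vs" by simp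
    have "{x, y} \<noteq> {y, z}" "{x, y} \<noteq> {l, x}" "{y, z} \<noteq> {l, x}"
      using dist l by (auto simp: vs doubleton_eq_iff)
    then have "card {{x, y}, {y, z}, {l, x}} = 3" by simp
    moreover have "card {{x, y}, {y, z}, {l, x}} \<le> card (cycle_edges vs)"
      using sub3 by (intro card_mono) (simp_all add: cycle_edges_def)
    moreover have "card (c ` cycle_edges vs) = card (cycle_edges vs)"
      using assms sub by (meson card_image inj_on_subset)
    ultimately show False using bi by (simp add: bichromatic_def)
  qed
  moreover have "proper_edge_coloring E c"
    using assms by (auto simp: proper_edge_coloring_def dest: inj_onD)
  ultimately show ?thesis by (auto simp: acyclic_edge_coloring_def)
qed

lemma (in finite_simple_graph) acyclic_chromatic_index_attained:
  "\<exists>c. acyclic_edge_coloring E c \<and> card (c ` E) = acyclic_chromatic_index E"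
proof -
  obtain c :: "'a set \<Rightarrow> nat" where "inj_on c E"
    using finite_imp_inj_to_nat_seg[OF finite_edges] by auto
  then have "\<exists>n c. acyclic_edge_coloring E c \<and> card (c ` E) = n"
    using inj_acyclic_edge_coloring by blast
  then show ?thesis unfolding acyclic_chromatic_index_def by (rule LeastI_ex)
qed

end

theory Submission
  imports Defs
begin

text \<open>
  Remove an edge \<open>xy\<close> with \<open>deg y \<le> k\<close> and color the rest by induction, so that the number \<open>t\<close> of
  edges at \<open>y\<close> whose color also occurs at \<open>x\<close> is minimal. If the coloring does not extend, every
  color \<open>b\<close> missing at \<open>x\<close> and \<open>y\<close> is blocked: for some edge \<open>yw\<close> counted by \<open>t\<close>, say of
  color \<open>a\<close>, the alternating \<open>(a, b)\<close>-path from \<open>y\<close> through \<open>w\<close> ends at \<open>x\<close>. If \<open>w\<close> is the only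
  neighbor of \<open>y\<close> at which \<open>b\<close> occurs, then any other edge \<open>yz\<close> counted by \<open>t\<close> can be recolored
  with \<open>b\<close>, because the only path that could close a bichromatic cycle at \<open>yz\<close> is the one that ends
  at \<open>x \<noteq> z\<close>; this decreases \<open>t\<close>. Hence for \<open>t \<ge> 2\<close> every missing color occurs at two or more
  neighbors of \<open>y\<close>, so there are at most \<open>(k - 1) (\<Delta> - 1) / 2\<close> of them, which is too few.
\<close>

section \<open>Paths and cycles as vertex lists\<close>

fun path_edges :: "'a list \<Rightarrow> 'a set set" where
  "path_edges (u # v # vs) = insert {u, v} (path_edges (v # vs))"
| "path_edges _ = {}"

text \<open>The start \<open>u\<close> stays outside the list, so that one step of the recursion
  moves the start and exchanges the two colors. Vertices may repeat.\<close>

fun alternating :: "'a set set \<Rightarrow> ('a set \<Rightarrow> nat) \<Rightarrow> nat \<Rightarrow> nat \<Rightarrow> 'a \<Rightarrow> 'a list \<Rightarrow> bool" where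
  "alternating E c a b u [] \<longleftrightarrow> True"
| "alternating E c a b u (w # ws) \<longleftrightarrow>
     {u, w} \<in> E \<and> c {u, w} = a \<and> alternating E c b a w ws"

lemma proper_edge_coloringD:
  "proper_edge_coloring E c \<Longrightarrow> e \<in> E \<Longrightarrow> f \<in> E \<Longrightarrow> v \<in> e \<Longrightarrow> v \<in> f \<Longrightarrow> c e = c f \<Longrightarrow> e = f"
  unfolding proper_edge_coloring_def by blast

lemma path_edges_subset: "e \<in> path_edges vs \<Longrightarrow> e \<subseteq> set vs"
  by (induction vs rule: path_edges.induct) auto

lemma path_edges_append2: "path_edges (vs @ [a, b]) = insert {a, b} (path_edges (vs @ [a]))"
  by (induction vs rule: path_edges.induct) auto

lemma path_edges_rev: "path_edges (rev vs) = path_edges vs"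
  by (induction vs rule: path_edges.induct) (auto simp: path_edges_append2 insert_commute)

lemma map2_path_edges:
  "set (map2 (\<lambda>u v. {u, v}) (u # zs) (zs @ [v])) = path_edges (u # zs @ [v])"
  by (induction zs arbitrary: u) auto

lemma cycle_edges_snoc:
  "cycle_edges (b # ws @ [a]) = insert {a, b} (path_edges (b # ws @ [a]))"
  using map2_path_edges[of b "ws @ [a]" b] path_edges_append2[of "b # ws" a b]
  by (simp add: cycle_edges_def)

lemma cycle_edges_rotate1: "cycle_edges (rotate1 vs) = cycle_edges vs"
proof (cases vs)
  case (Cons u us)
  show ?thesis
  proof (cases us)
    case Nil
    then show ?thesis using Cons by simp
  next
    case (Cons w ws)
    have "cycle_edges (w # ws @ [u]) = path_edges (u # w # ws @ [u])"
      by (simp add: cycle_edges_snoc)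
    also have "\<dots> = cycle_edges (u # w # ws)"
      using map2_path_edges[of u "w # ws" u] by (simp add: cycle_edges_def)
    finally show ?thesis using \<open>vs = u # us\<close> Cons by simp
  qed
qed simp

lemma cycle_edges_rotate: "cycle_edges (rotate n vs) = cycle_edges vs"
  by (induction n) (simp_all add: cycle_edges_rotate1)

text \<open>Rotating the vertex list turns \<open>{x, y}\<close> into the closing edge, and the
  remaining edges form a path. If the path runs from \<open>x\<close> to \<open>y\<close>, it is
  reversed. \<open>ws\<close> is nonempty because a cycle has at least three vertices.\<close>

lemma cycle_through_edge:
  assumes cyc: "is_cycle E vs" and xy: "{x, y} \<in> cycle_edges vs"
  obtains ws where "ws \<noteq> []" "distinct (y # ws @ [x])"
    "cycle_edges vs = insert {x, y} (path_edges (y # ws @ [x]))"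
proof -
  define n where "n = length vs"
  have n: "3 \<le> n" and dist: "distinct vs" using cyc by (auto simp: is_cycle_def n_def)
  obtain i where i: "i < n" and "{x, y} = {vs ! i, rotate1 vs ! i}"
    using xy by (auto simp: cycle_edges_def set_zip n_def)
  \<comment> \<open>Rotation by \<open>Suc i\<close> puts the successor of \<open>vs ! i\<close>
    first and \<open>vs ! i\<close> itself last.\<close>
  define us where "us = rotate (Suc i) vs"
  have us: "length us = n" "distinct us" "cycle_edges us = cycle_edges vs"
    using dist by (simp_all add: us_def n_def cycle_edges_rotate del: rotate_Suc)
  obtain b ws a where bwa: "us = b # ws @ [a]"
  proof -
    obtain b us' where "us = b # us'" using us(1) n by (cases us) auto
    moreover have "us' \<noteq> []" using us(1) n calculation by auto
    ultimately show ?thesis using that by (metis append_butlast_last_id)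
  qed
  have ws: "ws \<noteq> []" using us(1) n bwa by auto
  have "us ! 0 = vs ! (Suc i mod n)"
    using n nth_rotate[of 0 vs "Suc i"] unfolding us_def n_def by fastforce
  then have b: "b = rotate1 vs ! i" using i bwa by (simp add: nth_rotate1 n_def)
  have "us ! (n - 1) = vs ! ((Suc i + (n - 1)) mod n)"
    using n nth_rotate[of "n - 1" vs "Suc i"] unfolding us_def n_def by fastforce
  moreover have "(Suc i + (n - 1)) mod n = i" using i n by simp
  moreover have "us ! (n - 1) = a" using bwa us(1) by (auto simp: nth_append)
  ultimately have "a = vs ! i" by simp
  then have ab: "{x, y} = {a, b}" using b \<open>{x, y} = _\<close> by simp
  have ce: "cycle_edges vs = insert {x, y} (path_edges (b # ws @ [a]))"
    using us(3) bwa cycle_edges_snoc ab by metis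
  from ab consider "x = a" "y = b" | "x = b" "y = a" by (auto simp: doubleton_eq_iff)
  then show ?thesis
  proof cases
    case 1
    then show ?thesis using that[of ws] ws us(2) bwa ce by simp
  next
    case 2
    have "path_edges (b # ws @ [a]) = path_edges (a # rev ws @ [b])"
      using path_edges_rev[of "b # ws @ [a]"] by simp
    then show ?thesis using that[of "rev ws"] ws us(2) bwa ce 2 by auto
  qed
qed

section \<open>Alternating paths in a proper coloring\<close>

lemma alternating_mono: "alternating E c a b u ws \<Longrightarrow> E \<subseteq> E' \<Longrightarrow> alternating E' c a b u ws"
  by (induction ws arbitrary: u a b) auto

lemma alternating_cong:
  "alternating E c a b u ws \<Longrightarrow> (\<And>e. e \<in> E \<Longrightarrow> c e = c' e) \<Longrightarrow> alternating E c' a b u ws"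
  by (induction ws arbitrary: u a b) auto

lemma alternating_last:
  "alternating E c a b u ws \<Longrightarrow> ws \<noteq> [] \<Longrightarrow>
     \<exists>f\<in>E. last ws \<in> f \<and> c f = (if odd (length ws) then a else b)"
proof (induction ws arbitrary: u a b)
  case (Cons w ws)
  show ?case
  proof (cases "ws = []")
    case True
    then show ?thesis using Cons.prems by auto
  next
    case False
    then show ?thesis using Cons.prems Cons.IH[of b a w] by auto
  qed
qed simp

text \<open>Induction by two vertices at a time preserves both the parity and the order of the
  colors.\<close>

lemma alternating_append:
  "alternating E c a b u (p @ q) \<Longrightarrow> odd (length p) \<Longrightarrow> alternating E c b a (last p) q"
proof (induction p arbitrary: u a b rule: induct_list012)
  case (3 v w p)
  then have "p \<noteq> []" "odd (length p)" "alternating E c a b w (p @ q)" by auto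
  then show ?case using 3(1)[of a b w] by simp
qed auto

text \<open>Properness forces each step: at most one edge at a vertex has the color that comes
  next.\<close>

lemma alternating_prefix:
  assumes "proper_edge_coloring E c" "alternating E c a b u p" "alternating E c a b u q"
    "length p \<le> length q"
  shows "\<exists>r. q = p @ r"
  using assms(2-)
proof (induction p arbitrary: u a b q)
  case (Cons v p)
  then obtain w q' where q: "q = w # q'" by (cases q) auto
  have "{u, v} = {u, w}"
    using Cons.prems(1,2) q by (intro proper_edge_coloringD[OF assms(1), of _ _ u]) auto
  then have "v = w" by (auto simp: doubleton_eq_iff)
  then show ?case using Cons.IH[of b a v q'] Cons.prems q by auto
qed simp

text \<open>Consecutive edges of a path are distinct and share a vertex, so properness makes the two
  colors alternate; the last assumption settles which of them comes first.\<close>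

lemma alternating_pathI:
  assumes "proper_edge_coloring E c" "path_edges (u # ws) \<subseteq> E" "distinct (u # ws)"
    "c ` path_edges (u # ws) \<subseteq> {a, b}" "ws \<noteq> [] \<Longrightarrow> c {u, hd ws} \<noteq> b"
  shows "alternating E c a b u ws"
  using assms(2-)
proof (induction ws arbitrary: u a b)
  case (Cons w ws)
  have uw: "c {u, w} = a" using Cons.prems by auto
  have "c {w, hd ws} \<noteq> a" if "ws \<noteq> []"
  proof -
    obtain z zs where z: "ws = z # zs" using \<open>ws \<noteq> []\<close> by (cases ws) auto
    have "{u, w} \<noteq> {w, z}" using Cons.prems(2) z by (auto simp: doubleton_eq_iff)
    moreover have "{u, w} \<in> E" "{w, z} \<in> E" using Cons.prems(1) z by auto
    ultimately show ?thesis using proper_edge_coloringD[OF assms(1), of "{u, w}" "{w, z}" w] uw z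
      by (metis insertCI list.sel(1))
  qed
  then have "alternating E c b a w ws" using Cons.prems by (intro Cons.IH) auto
  then show ?case using Cons.prems uw by simp
qed simp

text \<open>Without \<open>{x, y}\<close> the cycle is a path from \<open>y\<close> to
  \<open>x\<close>. By properness its first and last edges avoid the color of \<open>{x, y}\<close>,
  so both have the other color \<open>a\<close> and the number of edges is odd.\<close>

lemma alternating_of_bichromatic_cycle:
  assumes pc: "proper_edge_coloring E c" and cyc: "is_cycle E vs" and bi: "bichromatic c vs"
    and xy: "{x, y} \<in> cycle_edges vs"
  obtains a ws where "alternating (E - {{x, y}}) c a (c {x, y}) y (ws @ [x])"
    "odd (length (ws @ [x]))"
proof -
  obtain ws where ws: "ws \<noteq> []" "distinct (y # ws @ [x])"
    and ce: "cycle_edges vs = insert {x, y} (path_edges (y # ws @ [x]))"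
    using cycle_through_edge[OF cyc xy] by blast
  let ?b = "c {x, y}"
  let ?E = "E - {{x, y}}"
  obtain w ws' where w: "ws = w # ws'" using ws by (cases ws) auto
  have "e \<noteq> {x, y}" if "e \<in> path_edges (y # ws @ [x])" for e
    using that path_edges_subset[of e "w # ws' @ [x]"] ws(2) w
    by (auto simp: doubleton_eq_iff)
  then have sub: "path_edges (y # ws @ [x]) \<subseteq> ?E"
    using cyc ce by (auto simp: is_cycle_def)
  have adj: "c f \<noteq> ?b" if "f \<in> ?E" "x \<in> f \<or> y \<in> f" for f
    using proper_edge_coloringD[OF pc, of f "{x, y}"] that xy cyc by (auto simp: is_cycle_def)
  have "card (c ` cycle_edges vs) = 2" using bi by (simp add: bichromatic_def)
  then obtain p q where "c ` cycle_edges vs = {p, q}" by (auto simp: card_2_iff)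
  moreover have "?b \<in> c ` cycle_edges vs" using xy by blast
  ultimately obtain a where a: "c ` cycle_edges vs = {a, ?b}"
    by (metis insert_commute insertE singletonD)
  have "proper_edge_coloring ?E c" using pc by (auto simp: proper_edge_coloring_def)
  moreover have "c {y, hd (ws @ [x])} \<noteq> ?b"
    using sub w by (intro adj) auto
  moreover have "c ` path_edges (y # ws @ [x]) \<subseteq> {a, ?b}" using a ce by auto
  ultimately have alt: "alternating ?E c a ?b y (ws @ [x])"
    using sub ws(2) by (intro alternating_pathI) auto
  moreover have "odd (length (ws @ [x]))"
  proof
    assume "even (length (ws @ [x]))"
    then show False using alternating_last[OF alt] adj by (auto split: if_splits)
  qed
  ultimately show ?thesis using that by blast
qed

section \<open>Changing the color of one edge\<close>

lemma acyclic_edge_coloring_subset: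
  "acyclic_edge_coloring E c \<Longrightarrow> E' \<subseteq> E \<Longrightarrow> acyclic_edge_coloring E' c"
  unfolding acyclic_edge_coloring_def proper_edge_coloring_def is_cycle_def
  by (meson subset_eq)

text \<open>Any new conflict or bichromatic cycle must use \<open>{x, y}\<close>.
  \<open>free\<close> excludes the conflicts; \<open>unblocked\<close> excludes the path that such a
  cycle leaves behind. This serves both to color a removed edge and to recolor an edge.\<close>

lemma acyclic_edge_coloring_upd:
  assumes acyc: "acyclic_edge_coloring (E - {{x, y}}) c"
    and free: "\<And>f. f \<in> E - {{x, y}} \<Longrightarrow> x \<in> f \<or> y \<in> f \<Longrightarrow> c f \<noteq> b"
    and unblocked: "\<And>a ws. alternating (E - {{x, y}}) c a b y (ws @ [x]) \<Longrightarrow>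
      odd (length (ws @ [x])) \<Longrightarrow> False"
  shows "acyclic_edge_coloring E (c({x, y} := b))"
proof -
  let ?c = "c({x, y} := b)"
  have pc: "proper_edge_coloring E ?c"
    unfolding proper_edge_coloring_def
  proof (intro ballI impI)
    fix e f assume ef: "e \<in> E" "f \<in> E" "e \<noteq> f \<and> e \<inter> f \<noteq> {}"
    consider "e = {x, y}" | "f = {x, y}" | "e \<noteq> {x, y}" "f \<noteq> {x, y}" by blast
    then show "?c e \<noteq> ?c f"
    proof cases
      case 1
      then show ?thesis using ef free[of f] by auto
    next
      case 2
      then show ?thesis using ef free[of e] by auto
    next
      case 3
      then show ?thesis using ef acyc
        by (simp add: acyclic_edge_coloring_def proper_edge_coloring_def)
    qed
  qed
  have False if cyc: "is_cycle E vs" and bi: "bichromatic ?c vs" for vs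
  proof (cases "{x, y} \<in> cycle_edges vs")
    case True
    obtain a ws where "alternating (E - {{x, y}}) ?c a b y (ws @ [x])" "odd (length (ws @ [x]))"
      using alternating_of_bichromatic_cycle[OF pc cyc bi True] by auto
    moreover have "?c f = c f" if "f \<in> E - {{x, y}}" for f using that by auto
    ultimately show False using unblocked alternating_cong[of "E - {{x, y}}" ?c a b y "ws @ [x]" c]
      by blast
  next
    case False
    then have "is_cycle (E - {{x, y}}) vs" using cyc by (auto simp: is_cycle_def)
    moreover have "?c ` cycle_edges vs = c ` cycle_edges vs"
      using False by (intro image_cong) auto
    then have "bichromatic c vs" using bi by (simp add: bichromatic_def)
    ultimately show False using acyc by (auto simp: acyclic_edge_coloring_def)
  qed
  then show ?thesis using pc by (auto simp: acyclic_edge_coloring_def)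
qed

section \<open>The counting inequality\<close>

text \<open>In the application \<open>d + 1\<close> bounds the degrees, \<open>e\<close> counts the
  colored edges at \<open>y\<close>, \<open>t\<close> those whose color also occurs at
  \<open>x\<close>, and \<open>n\<close> the colors missing at both ends. \<open>few\<close> counts
  the colors in use; \<open>n\<close> and \<open>two\<close> count how often missing colors are
  blocked.\<close>

lemma blocking_count_contradiction:
  fixes k d e n t N :: nat
  assumes "4 \<le> k" "(k + 1) * (d + 1) + 2 \<le> 2 * N" "e \<le> d" "e + 1 \<le> k"
    and few: "N + t \<le> n + d + e" and n: "n \<le> t * d" and two: "t \<le> 1 \<or> 2 * n \<le> e * d"
  shows False
proof -
  \<comment> \<open>Two lower bounds for \<open>N\<close>: from \<open>e + 2 \<le> k + 1\<close>,
    and from \<open>5 \<le> k + 1\<close>, which rests on \<open>4 \<le> k\<close>.\<close>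
  have "(e + 2) * (d + 1) \<le> (k + 1) * (d + 1)" "5 * (d + 1) \<le> (k + 1) * (d + 1)"
    using assms by (intro mult_le_mono1; simp)+
  then have N: "e * d + e + 2 * d + 4 \<le> 2 * N" "5 * d + 7 \<le> 2 * N"
    using assms(2) by (simp_all add: algebra_simps)
  consider "t = 0" | "t = 1" | "2 \<le> t" by linarith
  then show False
  proof cases
    case 1
    then show False using N few n \<open>e \<le> d\<close> by simp
  next
    case 2
    then have "n \<le> d" using n by simp
    \<comment> \<open>The bound with factor 5 forces this; then \<open>3 * d \<le> e * d\<close>
      makes the other bound contradictory.\<close>
    then have "3 \<le> e" using 2 N few \<open>e \<le> d\<close> by linarith
    then have "3 * d \<le> e * d" by simp
    then show False using 2 N few \<open>n \<le> d\<close> \<open>e \<le> d\<close> by linarith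
  next
    case 3
    then have "2 * n \<le> e * d" using two by simp
    \<comment> \<open>The double count makes \<open>t\<close> small compared with \<open>e\<close>,
      and then \<open>n \<le> t * d\<close> is too strong.\<close>
    then have "2 * t + 4 \<le> e" using N few by simp
    then have "(2 * t + 4) * d \<le> e * d" by (rule mult_le_mono1)
    then have "2 * (t * d) + 4 * d \<le> e * d" by (simp add: algebra_simps)
    then show False using N few n \<open>e \<le> d\<close> by simp
  qed
qed

section \<open>Extending a coloring by one edge\<close>

lemma extend_acyclic_edge_coloring:
  fixes c :: "'a set \<Rightarrow> nat"
  assumes fin: "finite E" and edge: "\<And>e. e \<in> E \<Longrightarrow> card e = 2"
    and xy: "{x, y} \<in> E" and deg: "\<And>v. degree E v \<le> D" and degy: "degree E y \<le> k"
    and k: "4 \<le> k" and N: "(k + 1) * D + 2 \<le> 2 * N"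
    and "acyclic_edge_coloring (E - {{x, y}}) c" "c ` (E - {{x, y}}) \<subseteq> {..<N}"
  shows "\<exists>c'. acyclic_edge_coloring E c' \<and> c' ` E \<subseteq> {..<N}"
  using assms(8,9)
\<comment> \<open>Induction on this number replaces the choice of a coloring that minimizes it: a
  recoloring with a smaller number falls under the induction hypothesis.\<close>
proof (induction "card {e \<in> E - {{x, y}}. y \<in> e \<and> c e \<in> c ` {f \<in> E - {{x, y}}. x \<in> f}}"
    arbitrary: c rule: less_induct)
  case (less c)
  \<comment> \<open>\<open>F\<close> is the colored part, \<open>card T\<close> is the induction
    measure, and \<open>C\<close> holds the candidate colors for \<open>{x, y}\<close>.\<close>
  define F where "F = E - {{x, y}}"
  define X where "X = {f \<in> F. x \<in> f}"
  define Y where "Y = {f \<in> F. y \<in> f}"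
  define T where "T = {e \<in> F. y \<in> e \<and> c e \<in> c ` X}"
  \<comment> \<open>the colors at the end of \<open>e\<close> other than \<open>y\<close>, when \<open>e \<in> Y\<close>\<close>
  define S where "S e = c ` {f \<in> F. y \<notin> f \<and> e \<inter> f \<noteq> {}}" for e
  define C where "C = {..<N} - (c ` X \<union> c ` Y)"
  have acyc: "acyclic_edge_coloring F c" and img: "c ` F \<subseteq> {..<N}"
    using less.prems by (simp_all add: F_def)
  have pc: "proper_edge_coloring F c" using acyc by (simp add: acyclic_edge_coloring_def)
  have finF: "finite F" "finite X" "finite Y" "finite T" "\<And>e. finite (S e)" "finite C"
    using fin by (simp_all add: F_def X_def Y_def T_def S_def C_def)
  have TY: "T \<subseteq> Y" by (auto simp: T_def Y_def)
  have xF: "{x, y} \<notin> F" "{y, x} \<notin> F" by (simp_all add: F_def insert_commute)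
  have "x \<noteq> y" using edge[OF xy] by auto
  have Y_other: "\<exists>w. e = {y, w} \<and> w \<noteq> y" if "e \<in> Y" for e
  proof -
    have "card e = 2" "y \<in> e" using that edge by (auto simp: Y_def F_def)
    then show ?thesis unfolding card_2_iff by blast
  qed
  show ?case
  proof (rule ccontr)
    assume no: "\<not> ?case"
    \<comment> \<open>The second edge of the path has color \<open>b\<close>, which is missing at
      \<open>y\<close>, so this edge avoids \<open>y\<close> and shows \<open>b\<close> at the far
      end of the first edge.\<close>
    have first: "\<exists>w. {y, w} \<in> Y \<and> c {y, w} = a \<and> b \<in> S {y, w}"
      if alt: "alternating F c a b y (ws @ [v])" "odd (length (ws @ [v]))" and ne: "ws \<noteq> []"
        and b: "b \<in> C" for a b ws v
    proof -
      obtain w ws' where w: "ws = w # ws'" using ne by (cases ws) auto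
      then obtain z zs where z: "ws' @ [v] = z # zs" by (cases ws') auto
      have e: "{y, w} \<in> F" "c {y, w} = a" and f: "{w, z} \<in> F" "c {w, z} = b"
        using alt(1) w z by auto
      have "y \<notin> {w, z}"
      proof
        assume "y \<in> {w, z}"
        then have "b \<in> c ` Y" using f by (auto simp: Y_def)
        then show False using b by (simp add: C_def)
      qed
      then have "b \<in> S {y, w}" using f by (auto simp: S_def)
      then show ?thesis using e by (auto simp: Y_def)
    qed
    have blocked: "\<exists>w ws. {y, w} \<in> T \<and> b \<in> S {y, w} \<and>
        alternating F c (c {y, w}) b y (ws @ [x]) \<and> odd (length (ws @ [x]))" if b: "b \<in> C" for b
    proof -
      have "\<not> acyclic_edge_coloring E (c({x, y} := b))"
      proof
        assume "acyclic_edge_coloring E (c({x, y} := b))"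
        moreover have "c({x, y} := b) ` E \<subseteq> {..<N}" using img b by (auto simp: F_def C_def)
        ultimately show False using no by blast
      qed
      moreover have "c f \<noteq> b" if "f \<in> F" "x \<in> f \<or> y \<in> f" for f
        using that b by (auto simp: C_def X_def Y_def)
      ultimately obtain a ws where
        alt: "alternating F c a b y (ws @ [x])" "odd (length (ws @ [x]))"
        using acyclic_edge_coloring_upd[of E x y c b] acyc unfolding F_def by blast
      have "ws \<noteq> []" using alt(1) xF by auto
      then obtain w where w: "{y, w} \<in> Y" "c {y, w} = a" "b \<in> S {y, w}"
        using first alt b by blast
      \<comment> \<open>Odd length gives the last edge, which lies at \<open>x\<close>, the color
        \<open>a\<close> of the first edge; hence \<open>{y, w}\<close> belongs to
        \<open>T\<close>.\<close>
      obtain f where "f \<in> F" "x \<in> f" "c f = a"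
        using alternating_last[OF alt(1)] alt(2) by auto
      then have "{y, w} \<in> T" using w by (auto simp: T_def X_def Y_def)
      then show ?thesis using w alt by blast
    qed
    have recolor: False
      if b: "b \<in> C" and j: "j \<in> T" "j \<noteq> e" and uniq: "\<And>f. f \<in> Y \<Longrightarrow> b \<in> S f \<Longrightarrow> f = e" for b e j
    proof -
      obtain w ws where w: "{y, w} \<in> T" "b \<in> S {y, w}"
        and alt: "alternating F c (c {y, w}) b y (ws @ [x])" "odd (length (ws @ [x]))"
        using blocked[OF b] by blast
      have e: "{y, w} = e" using w TY uniq by blast
      have jF: "j \<in> F" "j \<in> Y" "y \<in> j" using j TY by (auto simp: Y_def)
      obtain z where z: "j = {z, y}" "z \<noteq> y" using Y_other[OF jF(2)] by (auto simp: insert_commute)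
      have zx: "z \<noteq> x" using z jF xF by auto
      have atx: "c f \<noteq> b" if "f \<in> F" "x \<in> f" for f using that b by (auto simp: C_def X_def)
      \<comment> \<open>An edge of color \<open>b\<close> at \<open>z\<close> would put
        \<open>b\<close> into \<open>S j\<close>, and \<open>uniq\<close> would give
        \<open>j = e\<close>.\<close>
      have atz: "c f \<noteq> b" if "f \<in> F" "z \<in> f \<or> y \<in> f" for f
      proof
        assume "c f = b"
        then have "y \<notin> f" using b that by (auto simp: C_def Y_def)
        then have "b \<in> S j" using that z \<open>c f = b\<close> by (auto simp: S_def)
        then show False using uniq jF j by blast
      qed
      define c' where "c' = c({z, y} := b)"
      have "acyclic_edge_coloring F c'"
        unfolding c'_def
      proof (rule acyclic_edge_coloring_upd)
        show "acyclic_edge_coloring (F - {{z, y}}) c"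
          using acyc by (rule acyclic_edge_coloring_subset) auto
        show "c f \<noteq> b" if "f \<in> F - {{z, y}}" "z \<in> f \<or> y \<in> f" for f
          using that atz by auto
        show False if alt': "alternating (F - {{z, y}}) c a b y (vs @ [z])"
            and odd': "odd (length (vs @ [z]))" for a vs
        proof -
          have "vs \<noteq> []" using alt' by (auto simp: insert_commute)
          have alt': "alternating F c a b y (vs @ [z])"
            using alt' by (rule alternating_mono) auto
          obtain v where v: "{y, v} \<in> Y" "c {y, v} = a" "b \<in> S {y, v}"
            using first[OF alt' odd' \<open>vs \<noteq> []\<close> b] by blast
          \<comment> \<open>By \<open>uniq\<close>, a path blocking \<open>b\<close> at
            \<open>j\<close> starts with the edge \<open>e\<close>, hence has the same start and
            colors as the path ending at \<open>x\<close>.\<close>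
          then have "a = c {y, w}" using uniq[OF v(1,3)] e by simp
          then have alt_x: "alternating F c a b y (ws @ [x])" using alt(1) by simp
          \<comment> \<open>The shorter path is a prefix of the longer one, and a proper one as the
            ends differ. Having odd length, it would continue with color \<open>b\<close> at
            \<open>u\<close>, where \<open>b\<close> is missing.\<close>
          have stop: False if p: "alternating F c a b y (p @ [u])" "odd (length (p @ [u]))"
            and q: "alternating F c a b y (q @ [u'])" "u \<noteq> u'"
              "length (p @ [u]) \<le> length (q @ [u'])"
            and end_u: "\<And>f. f \<in> F \<Longrightarrow> u \<in> f \<Longrightarrow> c f \<noteq> b" for p u q u'
          proof -
            obtain r where r: "q @ [u'] = (p @ [u]) @ r"
              using alternating_prefix[OF pc p(1) q(1,3)] by blast
            have "r \<noteq> []" using r q(2) by auto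
            then obtain s r' where s: "r = s # r'" by (cases r) auto
            have "alternating F c b a u r"
              using alternating_append[of F c a b y "p @ [u]" r] p q r by simp
            then have "{u, s} \<in> F" "c {u, s} = b" using s by auto
            then show False using end_u by blast
          qed
          show False
          proof (cases "length (ws @ [x]) \<le> length (vs @ [z])")
            case True
            then show False using stop[OF alt_x alt(2) alt' zx[symmetric]] atx by blast
          next
            case False
            then have "length (vs @ [z]) \<le> length (ws @ [x])" by simp
            then show False using stop[OF alt' odd' alt_x zx] atz by blast
          qed
        qed
      qed
      moreover have "c' ` F \<subseteq> {..<N}" using img b by (auto simp: c'_def C_def)
      \<comment> \<open>Since \<open>j\<close> avoids \<open>x\<close>, the colors at
        \<open>x\<close> stay the same; \<open>j\<close> receives a color missing there and leaves
        \<open>T\<close>.\<close>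
      moreover have "card {e \<in> F. y \<in> e \<and> c' e \<in> c' ` X} < card T"
      proof -
        have "c' ` X = c ` X"
          using z zx \<open>x \<noteq> y\<close> by (intro image_cong) (auto simp: c'_def X_def doubleton_eq_iff)
        moreover have "b \<notin> c ` X" using b by (simp add: C_def)
        ultimately have "{e \<in> F. y \<in> e \<and> c' e \<in> c' ` X} \<subseteq> T - {j}"
          using z by (auto simp: c'_def T_def)
        moreover have "T - {j} \<subset> T" using j by blast
        ultimately show ?thesis using finF(4) by (meson psubset_card_mono subset_psubset_trans)
      qed
      ultimately show False
        using less.hyps[of c', folded F_def, folded X_def, folded T_def] no by simp
    qed
    have drop: "card {f \<in> F. v \<in> f} + 1 \<le> degree E v" if "v \<in> {x, y}" for v
    proof -
      have "insert {x, y} {f \<in> F. v \<in> f} = {f \<in> E. v \<in> f}" using that xy by (auto simp: F_def)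
      then have "degree E v = card (insert {x, y} {f \<in> F. v \<in> f})" by (simp add: degree_def)
      then show ?thesis using finF(1) xF by simp
    qed
    \<comment> \<open>The edge \<open>{x, y}\<close> makes \<open>D\<close> positive. It is
      uncolored, so at most \<open>d\<close> colored edges remain at each of its ends.\<close>
    obtain d where d: "D = d + 1" using drop[of x] deg[of x] by (cases D) auto
    have X: "card X \<le> d" using drop[of x] deg[of x] d by (simp add: X_def)
    have Y: "card Y \<le> d" "card Y + 1 \<le> k" using drop[of y] deg[of y] degy d
      by (simp_all add: Y_def)
    have S: "card (S e) \<le> d" if e: "e \<in> Y" for e
    proof -
      obtain w where w: "e = {y, w}" "w \<noteq> y" using Y_other[OF e] by blast
      have eE: "e \<in> E" using e by (auto simp: Y_def F_def)
      have "{f \<in> F. y \<notin> f \<and> e \<inter> f \<noteq> {}} \<subseteq> {f \<in> E. w \<in> f} - {e}"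
        using w by (auto simp: F_def)
      then have "card (S e) \<le> card ({f \<in> E. w \<in> f} - {e})"
        unfolding S_def using fin finF(1)
        by (intro card_image_le[THEN le_trans] card_mono) simp_all
      also have "\<dots> = degree E w - 1"
        using eE w fin by (simp add: degree_def)
      finally show ?thesis using deg[of w] d by simp
    qed
    have inj: "inj_on c X" "inj_on c Y"
      using proper_edge_coloringD[OF pc] by (auto simp: inj_on_def X_def Y_def)
    have "c ` X \<inter> c ` Y = c ` T"
    proof (intro equalityI subsetI)
      fix b assume "b \<in> c ` X \<inter> c ` Y"
      then have "b \<in> c ` X" "b \<in> c ` Y" by simp_all
      moreover from \<open>b \<in> c ` Y\<close> obtain e where "e \<in> Y" "b = c e" by (elim imageE)
      ultimately have "e \<in> T" by (simp add: T_def Y_def)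
      then show "b \<in> c ` T" using \<open>b = c e\<close> by simp
    qed (auto simp: T_def Y_def)
    moreover have "card (c ` T) = card T" using inj(2) TY by (meson card_image inj_on_subset)
    ultimately have XY: "card X + card Y = card (c ` X \<union> c ` Y) + card T"
      using card_Un_Int[of "c ` X" "c ` Y"] finF inj by (simp add: card_image)
    have "N - card (c ` X \<union> c ` Y) \<le> card C"
      using diff_card_le_card_Diff[of "c ` X \<union> c ` Y" "{..<N}"] finF by (simp add: C_def)
    then have few: "N + card T \<le> card C + d + card Y" using XY X by simp
    have "C \<subseteq> (\<Union>e\<in>T. S e)" using blocked by blast
    then have "card C \<le> card (\<Union>e\<in>T. S e)" using finF by (intro card_mono) auto
    also have "\<dots> \<le> (\<Sum>e\<in>T. card (S e))" using finF(4) by (rule card_UN_le)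
    also have "\<dots> \<le> card T * d"
      using sum_bounded_above[of T "\<lambda>e. card (S e)" d] S TY by auto
    finally have n: "card C \<le> card T * d" .
    have "2 * card C \<le> card Y * d" if t: "2 \<le> card T"
    proof -
      have two: "2 \<le> card {e \<in> Y. b \<in> S e}" if b: "b \<in> C" for b
      proof (rule ccontr)
        assume "\<not> ?thesis"
        moreover obtain e where e: "e \<in> T" "b \<in> S e" using blocked[OF b] by blast
        moreover have "0 < card {e \<in> Y. b \<in> S e}"
          using e TY finF(3) by (auto simp: card_gt_0_iff)
        ultimately have "card {e \<in> Y. b \<in> S e} = 1" by linarith
        then obtain g where "{e \<in> Y. b \<in> S e} = {g}" by (rule card_1_singletonE)
        then have "f = g" if "f \<in> Y" "b \<in> S f" for f using that by blast
        then have uniq: "f = e" if "f \<in> Y" "b \<in> S f" for f using that e TY by blast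
        have "T - {e} \<noteq> {}"
        proof
          assume "T - {e} = {}"
          then have "T \<subseteq> {e}" by blast
          then have "card T \<le> card {e}" by (intro card_mono) auto
          then show False using t by simp
        qed
        then obtain j where "j \<in> T" "j \<noteq> e" by blast
        then show False using recolor[OF b] uniq by blast
      qed
      have "2 * card C = (\<Sum>b\<in>C. 2)" by simp
      also have "\<dots> \<le> (\<Sum>b\<in>C. card {e \<in> Y. b \<in> S e})" using two by (rule sum_mono)
      also have "\<dots> = (\<Sum>e\<in>Y. card {b \<in> C. b \<in> S e})"
        using sum.swap_restrict[of C Y "\<lambda>_ _. 1::nat" "\<lambda>b e. b \<in> S e"] finF by simp
      also have "\<dots> \<le> (\<Sum>e\<in>Y. card (S e))"
        using finF by (intro sum_mono card_mono) auto
      also have "\<dots> \<le> card Y * d"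
        using sum_bounded_above[of Y "\<lambda>e. card (S e)" d] S by auto
      finally show ?thesis .
    qed
    then have "card T \<le> 1 \<or> 2 * card C \<le> card Y * d" by linarith
    then show False
      using blocking_count_contradiction[OF k _ Y few n] N d by simp
  qed
qed

lemma exists_acyclic_edge_coloring:
  assumes "finite E" and "\<And>e. e \<in> E \<Longrightarrow> card e = 2"
    and "\<And>v. degree E v \<le> D"
    and "\<And>F. F \<subseteq> E \<Longrightarrow> F \<noteq> {} \<Longrightarrow> \<exists>v. 0 < degree F v \<and> degree F v \<le> k"
    and k: "4 \<le> k" and N: "(k + 1) * D + 2 \<le> 2 * N"
  shows "\<exists>c. acyclic_edge_coloring E c \<and> c ` E \<subseteq> {..<N}"
  using assms(1-4)
proof (induction E rule: finite_psubset_induct)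
  case (psubset E)
  show ?case
  proof (cases "E = {}")
    case True
    then show ?thesis using inj_acyclic_edge_coloring[of _ E] by auto
  next
    case False
    then obtain y where y: "0 < degree E y" "degree E y \<le> k" using psubset.prems(3) by blast
    then obtain e where e: "e \<in> E" "y \<in> e"
      by (metis (no_types, lifting) card_eq_0_iff degree_def empty_Collect_eq less_irrefl)
    have "card e = 2" using e psubset.prems(1) by blast
    then obtain x where x: "e = {x, y}" using e unfolding card_2_iff by blast
    have mono: "degree F v \<le> degree E v" if "F \<subseteq> E" for F v
      unfolding degree_def using that psubset.hyps by (intro card_mono) auto
    have "\<exists>c. acyclic_edge_coloring (E - {{x, y}}) c \<and> c ` (E - {{x, y}}) \<subseteq> {..<N}"
    proof (rule psubset.IH)
      show "E - {{x, y}} \<subset> E" using e x by blast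
      show "degree (E - {{x, y}}) v \<le> D" for v
        using mono[of "E - {{x, y}}" v] psubset.prems(2)[of v] by auto
    qed (use psubset.prems in blast)+
    then show ?thesis
      using extend_acyclic_edge_coloring[OF psubset.hyps psubset.prems(1) _ psubset.prems(2) y(2) k N]
        e x by blast
  qed
qed

theorem theorem1:
  fixes V :: "'a set" and E :: "'a set set" and k :: nat
  assumes "k \<ge> 4"
    and "finite_simple_graph V E"
    and "degenerate k V E"
  shows "int (acyclic_chromatic_index E)
    \<le> \<lceil>(real k + 1) / 2 * real (max_degree V E)\<rceil> + 1"
proof -
  interpret finite_simple_graph V E by fact
  define D where "D = max_degree V E"
  define z where "z = \<lceil>(real k + 1) / 2 * real D\<rceil> + 1"
  have zD: "(real k + 1) / 2 * real D + 1 \<le> of_int z" by (simp add: z_def)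
  moreover have "0 \<le> (real k + 1) / 2 * real D" by simp
  ultimately have "0 \<le> real_of_int z" by linarith
  then have z: "0 \<le> z" "(real k + 1) / 2 * real D + 1 \<le> of_int z" using zD by simp_all
  then have "real ((k + 1) * D + 2) \<le> real (2 * nat z)" by (simp add: field_simps)
  then have N: "(k + 1) * D + 2 \<le> 2 * nat z" by (simp only: of_nat_le_iff)
  have deg: "degree E v \<le> D" for v
  proof (cases "v \<in> V")
    case True
    then show ?thesis using finite_verts by (auto simp: D_def max_degree_def)
  next
    case False
    then have "{e \<in> E. v \<in> e} = {}" using edge_subset by blast
    then show ?thesis by (simp only: degree_def card.empty)
  qed
  have low: "\<exists>v. 0 < degree F v \<and> degree F v \<le> k" if F: "F \<subseteq> E" "F \<noteq> {}" for F
  proof -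
    have "subgraph (\<Union>F) F V E"
      using F edge_subset edge_card by (auto simp: subgraph_def simple_graph_def)
    moreover have "\<Union>F \<noteq> {}" using F edge_card by fastforce
    ultimately obtain v where v: "v \<in> \<Union>F" "degree F v \<le> k"
      using assms(3) unfolding degenerate_def by blast
    then have "0 < degree F v"
      using finite_subset[OF F(1) finite_edges] by (auto simp: degree_def card_gt_0_iff)
    then show ?thesis using v by blast
  qed
  obtain c where c: "acyclic_edge_coloring E c" "c ` E \<subseteq> {..<nat z}"
    using exists_acyclic_edge_coloring[OF finite_edges edge_card deg low assms(1) N] by blast
  have "acyclic_chromatic_index E \<le> card (c ` E)"
    unfolding acyclic_chromatic_index_def using c(1) by (intro Least_le) blast
  also have "\<dots> \<le> card {..<nat z}" using c(2) by (intro card_mono) auto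
  finally show ?thesis using z(1) by (simp add: z_def D_def)
qed

end
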